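(* For all integers $s \geq 2$ and all integers $m \geq 1$, $$A_{s+1,s}(m) = \binom{m - \lceil s/2\rceil}{\lfloor s/2 \rfloor},$$ where the binomial coefficient $\binom{n}{j}$ is understood to be $0$ if $n < j$ (in particular if $n<0$).
   Context: All sequences are finite. A block is a contiguous, possibly empty, segment of a sequence whose letters are pairwise distinct. A sequence is on $m$ blocks if it is given as a concatenation of $m$ consecutive blocks. An alternation of length $s$ is a sequence $abab\cdots$ of length $s$ with $a \neq b$ distinct letters. A sequence avoids alternations of length $s$ if none of its (not necessarily contiguous) subsequences is an alternation of length $s$. For positive integers $s,k,m$, $A_{s,k}(m)$ denotes the maximum (supremum, possibly $\infty$) number of distinct letters in a sequence on $m$ blocks that avoids alternations of length $s$ and in which every letter that occurs does so at least $k$ times. The empty sequence is allowed, so $A_{s,k}(m)=0$ if $m<k$. *)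

theory Defs
  imports Complex_Main "HOL-Library.Sublist" "HOL-Library.Extended_Nat"
begin

definition on_blocks :: "nat \<Rightarrow> 'a list \<Rightarrow> bool" where
  "on_blocks m xs \<longleftrightarrow>
     (\<exists>bs. length bs = m \<and> (\<forall>b \<in> set bs. distinct b) \<and> xs = concat bs)"

definition is_alternation :: "nat \<Rightarrow> 'a list \<Rightarrow> bool" where
  "is_alternation s ys \<longleftrightarrow>
     (\<exists>a b. a \<noteq> b \<and> ys = map (\<lambda>i. if even i then a else b) [0..<s])"

definition avoids_alternations :: "nat \<Rightarrow> 'a list \<Rightarrow> bool" where
  "avoids_alternations s xs \<longleftrightarrow> \<not> (\<exists>ys. subseq ys xs \<and> is_alternation s ys)"

(* This is A_{s,k}(m). Sequences are finite, so natural numbers suffice as an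
   alphabet that puts no bound on the number of distinct letters. *)
definition max_letters :: "nat \<Rightarrow> nat \<Rightarrow> nat \<Rightarrow> enat" where
  "max_letters s k m =
     (SUP xs \<in> {xs :: nat list. on_blocks m xs \<and> avoids_alternations s xs \<and>
                    (\<forall>x \<in> set xs. k \<le> count_list xs x)}.
        enat (card (set xs)))"

end

theory Submission
  imports Defs
begin

text \<open>
  Upper bound: map a letter to the blocks of its 2nd, 4th, 6th, \<dots> occurrences. These are
  pairwise non-adjacent blocks, none of them the first one (nor the last one, if s is odd), so there
  are only as many values as claimed. If two letters have the same value, then both occur in each of
  s consecutive segments: alternately strictly between two of the common blocks, and inside a common
  block. So an alternation can pick one letter from each segment, and both from the first one, which
  gives length s + 1.

  Lower bound, s = 2t: the letters are the sets S of t pairwise disjoint pairs of neighbouring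
  blocks d, d + 1. Keep a move-to-front list of all letters; at step d write the letters that own d
  in the order of the list at the end of block d, and again in reverse order at the beginning of
  block d + 1, then move them to the front. Two letters p, q sharing d contribute p q q p, where p
  is the one written last before; hence a shared pair costs two changes and any other pair at most
  one. The initial order is chosen to save one more change. For odd s, prepend a block with the
  initial order reversed.
\<close>

section \<open>Alternations\<close>

definition alternation :: "'a \<Rightarrow> 'a \<Rightarrow> nat \<Rightarrow> 'a list" where
  "alternation a b n = map (\<lambda>i. if even i then a else b) [0..<n]"

lemma alternation_0 [simp]: "alternation a b 0 = []"
  by (simp add: alternation_def)

lemma alternation_Suc [simp]: "alternation a b (Suc n) = a # alternation b a n"
  unfolding alternation_def map_upt_Suc by (auto simp: comp_def)

lemma set_alternation_subset: "set (alternation a b n) \<subseteq> {a, b}"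
  by (auto simp: alternation_def)

lemma is_alternation_iff: "is_alternation n ys \<longleftrightarrow> (\<exists>a b. a \<noteq> b \<and> ys = alternation a b n)"
  by (simp add: is_alternation_def alternation_def)

text \<open>The virtual preceding letter \<open>c\<close> lets the count continue across a
  concatenation; the lower bound chooses it to save a change at the start.\<close>

fun changes :: "'a \<Rightarrow> 'a list \<Rightarrow> nat" where
  "changes c [] = 0"
| "changes c (x # xs) = (if x = c then 0 else 1) + changes x xs"

lemma changes_le_Suc: "changes c xs \<le> Suc (changes d xs)"
  by (cases xs) auto

text \<open>Deleting \<open>y\<close> obeys a triangle inequality: going on from \<open>c\<close>
  instead of \<open>y\<close> costs at most one more change, and only if \<open>y\<close> differs
  from \<open>c\<close>, when \<open>y\<close> itself had cost one.\<close>

lemma changes_mono_subseq: "subseq ys xs \<Longrightarrow> changes c ys \<le> changes c xs"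
proof (induction arbitrary: c rule: list_emb.induct)
  case (list_emb_Cons xs ys y)
  have "changes c xs \<le> (if y = c then 0 else 1) + changes y xs"
    using changes_le_Suc[of c xs y] by auto
  then show ?case using list_emb_Cons.IH[of y] by simp
qed auto

lemma changes_alternation: "a \<noteq> b \<Longrightarrow> changes a (alternation b a n) = n"
  by (induction n arbitrary: a b) auto

lemma changes_alternation_ge: "a \<noteq> b \<Longrightarrow> n \<le> changes c (alternation a b (Suc n))"
  by (simp add: changes_alternation)

section \<open>Sparse sets\<close>

definition sparse_sets :: "nat \<Rightarrow> nat \<Rightarrow> nat set set" where
  "sparse_sets n t = {D. D \<subseteq> {..<n} \<and> card D = t \<and> (\<forall>d\<in>D. Suc d \<notin> D)}"

lemma finite_sparse_sets: "finite (sparse_sets n t)"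
  by (rule finite_subset[of _ "Pow {..<n}"]) (auto simp: sparse_sets_def)

text \<open>Split by membership of the largest candidate \<open>Suc n\<close>: a set containing it
  omits \<open>n\<close>, so its rest lies below \<open>n\<close>.\<close>

lemma sparse_sets_Suc_Suc:
  "sparse_sets (Suc (Suc n)) (Suc t) =
     sparse_sets (Suc n) (Suc t) \<union> insert (Suc n) ` sparse_sets n t" (is "?L = ?R")
proof
  show "?L \<subseteq> ?R"
  proof
    fix D assume D: "D \<in> ?L"
    show "D \<in> ?R"
    proof (cases "Suc n \<in> D")
      case True
      have fin: "finite D" using D finite_subset by (auto simp: sparse_sets_def)
      have n: "n \<notin> D" using D True by (auto simp: sparse_sets_def)
      have "x < n" if "x \<in> D" "x \<noteq> Suc n" for x
      proof -
        have "x < Suc (Suc n)" using D that by (auto simp: sparse_sets_def)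
        moreover have "x \<noteq> n" using n that by auto
        ultimately show ?thesis using that by linarith
      qed
      then have "D - {Suc n} \<in> sparse_sets n t"
        using D True fin by (auto simp: sparse_sets_def)
      moreover have "D = insert (Suc n) (D - {Suc n})" using True by auto
      ultimately show ?thesis by blast
    next
      case False
      then have "x < Suc n" if "x \<in> D" for x
        using D that less_Suc_eq by (auto simp: sparse_sets_def)
      then show ?thesis using D by (auto simp: sparse_sets_def)
    qed
  qed
next
  have "insert (Suc n) D \<in> ?L" if D: "D \<in> sparse_sets n t" for D
  proof -
    have lt: "x < n" if "x \<in> D" for x using D that by (auto simp: sparse_sets_def)
    have "finite D" using D finite_subset by (auto simp: sparse_sets_def)
    moreover have "Suc n \<notin> D" using lt[of "Suc n"] by auto
    moreover have "Suc (Suc n) \<notin> D" using lt[of "Suc (Suc n)"] by auto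
    moreover have "n \<notin> D" using lt[of n] by auto
    ultimately show ?thesis using D lt by (auto simp: sparse_sets_def less_Suc_eq)
  qed
  then show "?R \<subseteq> ?L" by (auto simp: sparse_sets_def)
qed

lemma card_sparse_sets: "card (sparse_sets n t) = (Suc n - t) choose t"
proof (induction n arbitrary: t rule: induct_nat_012)
  case 0
  have "sparse_sets 0 t = (if t = 0 then {{}} else {})"
    by (auto simp: sparse_sets_def)
  then show ?case by (cases t) auto
next
  case 1
  have D: "D = {} \<or> D = {0}" if "D \<subseteq> {..<Suc 0}" for D :: "nat set"
    using that by (auto simp: lessThan_Suc)
  have "sparse_sets (Suc 0) t = (if t = 0 then {{}} else if t = 1 then {{0}} else {})"
    by (auto simp: sparse_sets_def dest!: D)
  then show ?case by (cases t; cases "t - 1") (auto simp: binomial_eq_0)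
next
  case (ge2 n)
  show ?case
  proof (cases t)
    case 0
    have "sparse_sets (Suc (Suc n)) 0 = {{}}"
      using finite_subset by (fastforce simp: sparse_sets_def)
    then show ?thesis using 0 by simp
  next
    case (Suc r)
    have out: "Suc n \<notin> D" if "D \<in> sparse_sets n r" for D
      using that by (auto simp: sparse_sets_def)
    have "inj_on (insert (Suc n)) (sparse_sets n r)"
      using out by (intro inj_onI) (metis insert_ident)
    then have card_image: "card (insert (Suc n) ` sparse_sets n r) = (Suc n - r) choose r"
      using ge2 by (simp add: card_image)
    have "sparse_sets (Suc n) (Suc r) \<inter> insert (Suc n) ` sparse_sets n r = {}"
      by (auto simp: sparse_sets_def)
    then have "card (sparse_sets (Suc (Suc n)) t) =
        ((Suc (Suc n) - Suc r) choose Suc r) + ((Suc n - r) choose r)"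
      unfolding Suc sparse_sets_Suc_Suc
      by (subst card_Un_disjoint) (auto simp: finite_sparse_sets card_image ge2)
    also have "\<dots> = (Suc (Suc (Suc n)) - t) choose t"
    \<comment> \<open>Pascal's rule; if \<open>r > Suc n\<close>, all differences truncate to 0 and
      every term vanishes.\<close>
    proof (cases "r \<le> Suc n")
      case True
      then show ?thesis by (simp add: Suc Suc_diff_le)
    next
      case False
      then show ?thesis by (simp add: Suc)
    qed
    finally show ?thesis .
  qed
qed

section \<open>The upper bound\<close>

lemma concat_drop_split:
  assumes "q \<le> k" "k < length bs"
  obtains us where "concat (drop q bs) = us @ bs ! k @ concat (drop (Suc k) bs)"
proof -
  have "drop q bs = take (k - q) (drop q bs) @ drop k bs"
    using assms by (metis append_take_drop_id drop_drop le_add_diff_inverse2)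
  also have "drop k bs = bs ! k # drop (Suc k) bs"
    using assms by (simp add: Cons_nth_drop_Suc)
  finally have "concat (drop q bs) =
      concat (take (k - q) (drop q bs)) @ bs ! k @ concat (drop (Suc k) bs)"
    by (metis concat.simps(2) concat_append)
  then show ?thesis by (rule that)
qed

lemma subseq_Cons_concat_drop:
  assumes "q \<le> k" "k < length bs" "a \<in> set (bs ! k)" "subseq xs (concat (drop (Suc k) bs))"
  shows "subseq (a # xs) (concat (drop q bs))"
proof -
  obtain us where us: "concat (drop q bs) = us @ bs ! k @ concat (drop (Suc k) bs)"
    using concat_drop_split assms by blast
  have "subseq ([a] @ xs) (bs ! k @ concat (drop (Suc k) bs))"
    using assms by (intro list_emb_append_mono) (auto simp: subseq_singleton_left)
  then show ?thesis unfolding us by (simp add: list_emb_append2)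
qed

text \<open>Take \<open>a\<close> from block \<open>f j\<close>, \<open>b\<close> from
  \<open>g (Suc j)\<close>, and so on in ever later blocks; the induction swaps the letters, hence
  the symmetric hypotheses. For \<open>n = 0\<close> the index \<open>j = s\<close> is out of range,
  so \<open>q\<close> is then unconstrained.\<close>

lemma subseq_alternation_concat_drop:
  assumes "\<And>j. j < s \<Longrightarrow> f j < length bs \<and> a \<in> set (bs ! f j)"
    and "\<And>j. j < s \<Longrightarrow> g j < length bs \<and> b \<in> set (bs ! g j)"
    and "\<And>j. Suc j < s \<Longrightarrow> f j < g (Suc j) \<and> g j < f (Suc j)"
    and "j + n = s" and "n > 0 \<Longrightarrow> q \<le> f j"
  shows "subseq (alternation a b n) (concat (drop q bs))"
  using assms
proof (induction n arbitrary: j a b f g q)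
  case (Suc n)
  have "subseq (alternation b a n) (concat (drop (Suc (f j)) bs))"
  proof (rule Suc.IH[of g b f a "Suc j"])
    show "Suc (f j) \<le> g (Suc j)" if "n > 0"
      using Suc.prems(3)[of j] Suc.prems(4) that by simp
  qed (use Suc.prems in auto)
  then show ?case
    unfolding alternation_Suc
    using Suc.prems by (intro subseq_Cons_concat_drop[of q "f j"]) auto
qed auto

lemma subseq_pair:
  assumes "a \<in> set xs" "b \<in> set xs" "a \<noteq> b"
  shows "subseq [a, b] xs \<or> subseq [b, a] xs"
  using assms
proof (induction xs)
  case (Cons x xs)
  then show ?case by (auto simp: subseq_singleton_left)
qed auto

text \<open>One letter per stage \<open>j\<close> alternates from either start, giving length
  \<open>s\<close>. If \<open>f 0\<close> and \<open>g 0\<close> differ, the earlier of these blocks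
  supplies the extra first letter.\<close>

lemma alternation_of_interleaved_occurrences:
  assumes f: "\<And>j. j < s \<Longrightarrow> f j < length bs \<and> a \<in> set (bs ! f j)"
    and g: "\<And>j. j < s \<Longrightarrow> g j < length bs \<and> b \<in> set (bs ! g j)"
    and fg: "\<And>j. Suc j < s \<Longrightarrow> f j < g (Suc j) \<and> g j < f (Suc j)"
    and less: "\<And>j. Suc j < s \<Longrightarrow> f j < f (Suc j) \<and> g j < g (Suc j)"
    and "a \<noteq> b" "s > 0"
  shows "\<not> avoids_alternations (Suc s) (concat bs)"
proof -
  have alt: "subseq (alternation a b n) (concat (drop q bs))"
    if "j + n = s" "n > 0 \<Longrightarrow> q \<le> f j" for j n q
    using subseq_alternation_concat_drop[of s f bs a g b j n q, OF f g fg that] by auto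
  have alt': "subseq (alternation b a n) (concat (drop q bs))"
    if "j + n = s" "n > 0 \<Longrightarrow> q \<le> g j" for j n q
    using subseq_alternation_concat_drop[of s g bs b f a j n q, OF g f _ that] fg by auto
  obtain r where r: "s = Suc r" using \<open>s > 0\<close> gr0_implies_Suc by blast
  have "subseq (alternation a b (Suc s)) (concat (drop 0 bs)) \<or>
        subseq (alternation b a (Suc s)) (concat (drop 0 bs))"
  proof (cases "f 0" "g 0" rule: linorder_cases)
    case less
    then show ?thesis
      using f[of 0] alt'[of 0 s "Suc (f 0)"] \<open>s > 0\<close>
      unfolding alternation_Suc by (intro disjI1 subseq_Cons_concat_drop[of 0 "f 0"]) auto
  next
    case greater
    then show ?thesis
      using g[of 0] alt[of 0 s "Suc (g 0)"] \<open>s > 0\<close>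
      unfolding alternation_Suc by (intro disjI2 subseq_Cons_concat_drop[of 0 "g 0"]) auto
  next
    case equal
    \<comment> \<open>One block holds both first letters, in an order that cannot be chosen; the
      other \<open>s - 1\<close> letters come from later blocks and may start with either
      letter.\<close>
    obtain us where us: "concat (drop 0 bs) = us @ bs ! f 0 @ concat (drop (Suc (f 0)) bs)"
      using concat_drop_split[of 0 "f 0" bs] f[of 0] \<open>s > 0\<close> by auto
    have "0 < r \<Longrightarrow> Suc (f 0) \<le> f 1" "0 < r \<Longrightarrow> Suc (f 0) \<le> g 1"
      using less[of 0] r equal by auto
    then have tails: "subseq (alternation a b r) (concat (drop (Suc (f 0)) bs))"
         "subseq (alternation b a r) (concat (drop (Suc (f 0)) bs))"
      using alt[of 1 r "Suc (f 0)"] alt'[of 1 r "Suc (f 0)"] r by fastforce+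
    consider "subseq [a, b] (bs ! f 0)" | "subseq [b, a] (bs ! f 0)"
      using subseq_pair[of a "bs ! f 0" b] f[of 0] g[of 0] equal \<open>a \<noteq> b\<close> \<open>s > 0\<close> by auto
    then show ?thesis
    proof cases
      case 1
      then have "subseq ([a, b] @ alternation a b r) (bs ! f 0 @ concat (drop (Suc (f 0)) bs))"
        using tails by (intro list_emb_append_mono)
      then show ?thesis unfolding us r by (simp add: list_emb_append2)
    next
      case 2
      then have "subseq ([b, a] @ alternation b a r) (bs ! f 0 @ concat (drop (Suc (f 0)) bs))"
        using tails by (intro list_emb_append_mono)
      then show ?thesis unfolding us r by (simp add: list_emb_append2)
    qed
  qed
  then show ?thesis
    using \<open>a \<noteq> b\<close> unfolding avoids_alternations_def is_alternation_iff drop_0 by metis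
qed

section \<open>Letters counted by sparse sets of blocks\<close>

lemma count_list_distinct: "distinct xs \<Longrightarrow> count_list xs x = (if x \<in> set xs then 1 else 0)"
  by (induction xs) auto

lemma count_list_concat_distinct:
  assumes "\<forall>b\<in>set bs. distinct b"
  shows "count_list (concat bs) x = card {i. i < length bs \<and> x \<in> set (bs ! i)}"
proof -
  have "count_list (concat bs) x = length (filter (\<lambda>b. x \<in> set b) bs)"
    using assms by (induction bs) (auto simp: count_list_distinct)
  then show ?thesis by (simp add: length_filter_conv_card)
qed

text \<open>\<open>Suc s - 2 * t\<close> is 1 for even \<open>s\<close> and 2 for odd
  \<open>s\<close>: an earlier occurrence excludes the first block, and for odd \<open>s\<close> a
  later one excludes the last.\<close>

lemma card_letters_le:
  assumes bs: "\<forall>b\<in>set bs. distinct b" and avoids: "avoids_alternations (Suc s) (concat bs)"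
    and count: "\<forall>x\<in>set (concat bs). s \<le> count_list (concat bs) x"
    and t: "t > 0" "2 * t \<le> s" "s \<le> Suc (2 * t)"
  shows "card (set (concat bs)) \<le> card (sparse_sets (length bs - (Suc s - 2 * t)) t)"
proof -
  define occ where "occ x = sorted_list_of_set {i. i < length bs \<and> x \<in> set (bs ! i)}" for x
  define p where "p x j = occ x ! j" for x j
  \<comment> \<open>\<open>p x j\<close> counts from 0, so the odd indices are the 2nd, 4th, \<dots> occurrences.\<close>
  define ds where "ds x = map (\<lambda>i. p x (2 * i + 1) - 1) [0..<t]" for x
  have len: "s \<le> length (occ x)" if "x \<in> set (concat bs)" for x
    using bspec[OF count that] count_list_concat_distinct[OF bs, of x] by (simp add: occ_def)
  have p_in: "p x j < length bs \<and> x \<in> set (bs ! p x j)" if "x \<in> set (concat bs)" "j < s" for x j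
  proof -
    have "p x j \<in> set (occ x)" using len[OF that(1)] that(2) by (simp add: p_def)
    then show ?thesis by (simp add: occ_def)
  qed
  have p_less: "p x i < p x j" if "x \<in> set (concat bs)" "i < j" "j < s" for x i j
  proof -
    have "sorted_wrt (<) (occ x)" by (simp add: occ_def)
    then show ?thesis
      using len[OF that(1)] that sorted_wrt_nth_less unfolding p_def by fastforce
  qed
  have length_ds: "length (ds x) = t" for x by (simp add: ds_def)
  have ds_nth: "ds x ! i = p x (2 * i + 1) - 1" if "i < t" for x i
    using that by (simp add: ds_def)
  have ds_less: "Suc (ds x ! i) < ds x ! j" if "x \<in> set (concat bs)" "i < j" "j < t" for x i j
  proof -
    \<comment> \<open>The occurrence with index \<open>2 * i + 2\<close> separates the two blocks;
      the one with index 0 makes them positive, so subtracting 1 does not truncate.\<close>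
    have "p x 0 < p x (2 * i + 1)" "p x (2 * i + 1) < p x (2 * i + 2)"
      "p x (2 * i + 2) < p x (2 * j + 1)"
      using that t by (auto intro!: p_less)
    then show ?thesis using that by (simp add: ds_nth)
  qed
  have ds_sorted: "sorted_wrt (<) (ds x)" if "x \<in> set (concat bs)" for x
    unfolding sorted_wrt_iff_nth_less using ds_less[OF that] by (fastforce simp: length_ds)
  have "set (ds x) \<in> sparse_sets (length bs - (Suc s - 2 * t)) t" if x: "x \<in> set (concat bs)" for x
    unfolding sparse_sets_def
  proof (intro CollectI conjI ballI subsetI)
    show "d \<in> {..<length bs - (Suc s - 2 * t)}" if "d \<in> set (ds x)" for d
    proof -
      obtain i where i: "i < t" "d = p x (2 * i + 1) - 1"
        using \<open>d \<in> set (ds x)\<close> by (auto simp: ds_def)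
      have "p x 0 < p x (2 * i + 1)" using i t by (intro p_less[OF x]) auto
      moreover have "p x (2 * i + 1) \<le> p x (2 * t - 1)"
      proof (cases "Suc i = t")
        case True
        then have "2 * i + 1 = 2 * t - 1" by auto
        then show ?thesis by simp
      next
        case False
        then show ?thesis using i t by (intro less_imp_le p_less[OF x]) auto
      qed
      moreover have "p x (2 * t - 1) + (s - 2 * t) < length bs"
      proof (cases "s = 2 * t")
        case True
        then show ?thesis using p_in[OF x, of "2 * t - 1"] t by simp
      next
        case False
        then have "s = Suc (2 * t)" using t by simp
        then show ?thesis
          using p_less[OF x, of "2 * t - 1" "2 * t"] p_in[OF x, of "2 * t"] t by simp
      qed
      ultimately show ?thesis using i t by auto
    qed
    have "distinct (ds x)" using ds_sorted[OF x] by (simp add: strict_sorted_iff)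
    then show "card (set (ds x)) = t" by (simp add: distinct_card length_ds)
    show "Suc d \<notin> set (ds x)" if "d \<in> set (ds x)" for d
    proof
      assume "Suc d \<in> set (ds x)"
      then obtain i j where ij: "i < t" "j < t" "d = ds x ! i" "Suc d = ds x ! j"
        using \<open>d \<in> set (ds x)\<close> by (auto simp: in_set_conv_nth length_ds)
      then show False
        using ds_less[OF x, of i j] ds_less[OF x, of j i] by (cases i j rule: linorder_cases) auto
    qed
  qed
  moreover have "inj_on (\<lambda>x. set (ds x)) (set (concat bs))"
  proof (rule inj_onI, rule ccontr)
    fix x y assume x: "x \<in> set (concat bs)" and y: "y \<in> set (concat bs)"
      and eq: "set (ds x) = set (ds y)" and "x \<noteq> y"
    have "ds x = ds y" using ds_sorted x y eq by (intro strict_sorted_equal) auto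
    have odd_eq: "p x j = p y j" if "odd j" "j < 2 * t" for j
    proof -
      obtain i where i: "j = 2 * i + 1" using \<open>odd j\<close> oddE by blast
      have "p x 0 < p x j" "p y 0 < p y j" using i that t x y by (auto intro!: p_less)
      moreover have "p x j - 1 = p y j - 1"
        using \<open>ds x = ds y\<close> ds_nth[of i x] ds_nth[of i y] i that by simp
      ultimately show ?thesis by linarith
    qed
    \<comment> \<open>One of \<open>j\<close> and \<open>Suc j\<close> is odd and below
      \<open>2 * t\<close>, so both letters share its block; each letter's own strict increase then
      gives both inequalities.\<close>
    have "p x j < p y (Suc j) \<and> p y j < p x (Suc j)" if "Suc j < s" for j
    proof (cases "odd j")
      case True
      then have "j < 2 * t" using that t by linarith
      then show ?thesis
        using odd_eq[of j] True that p_less[OF x, of j "Suc j"] p_less[OF y, of j "Suc j"] by simp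
    next
      case False
      then have "Suc j \<noteq> 2 * t" by (metis even_Suc even_mult_iff even_numeral)
      then have "Suc j < 2 * t" using that t by linarith
      then show ?thesis
        using odd_eq[of "Suc j"] False that p_less[OF x, of j "Suc j"] p_less[OF y, of j "Suc j"]
        by simp
    qed
    then have "\<not> avoids_alternations (Suc s) (concat bs)"
      using p_in x y p_less \<open>x \<noteq> y\<close> t
      by (intro alternation_of_interleaved_occurrences[of s "p x" bs x "p y" y]) auto
    then show False using avoids by simp
  qed
  ultimately show ?thesis
    by (intro card_inj_on_le[of "\<lambda>x. set (ds x)"]) (auto simp: finite_sparse_sets)
qed

section \<open>The extremal sequence\<close>

definition to_front :: "('a \<Rightarrow> nat set) \<Rightarrow> nat \<Rightarrow> 'a list \<Rightarrow> 'a list" where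
  "to_front S d xs = filter (\<lambda>x. d \<in> S x) xs @ filter (\<lambda>x. d \<notin> S x) xs"

text \<open>Here \<open>d \<in> S x\<close> means that \<open>x\<close> occurs at the end of block \<open>d\<close> and at the beginning of
  block \<open>d + 1\<close>.\<close>

fun zigzag :: "('a \<Rightarrow> nat set) \<Rightarrow> nat list \<Rightarrow> 'a list \<Rightarrow> 'a list" where
  "zigzag S [] xs = []"
| "zigzag S (d # ds) xs =
     filter (\<lambda>x. d \<in> S x) xs @ rev (filter (\<lambda>x. d \<in> S x) xs) @ zigzag S ds (to_front S d xs)"

lemma set_to_front [simp]: "set (to_front S d xs) = set xs"
  by (auto simp: to_front_def)

lemma distinct_to_front [simp]: "distinct (to_front S d xs) \<longleftrightarrow> distinct xs"
  by (induction xs) (auto simp: to_front_def)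

lemma filter_to_front: "filter P (to_front S d xs) = to_front S d (filter P xs)"
  by (simp add: to_front_def conj_commute)

text \<open>Restricting to two letters commutes with the construction, so alternations can be
  studied on orders of length 2.\<close>

lemma filter_zigzag: "filter P (zigzag S ds xs) = zigzag S ds (filter P xs)"
  by (induction ds arbitrary: xs) (simp_all add: filter_to_front rev_filter conj_commute)

lemma set_foldr_to_front [simp]: "set (foldr (to_front S) ds xs) = set xs"
  by (induction ds) auto

lemma distinct_foldr_to_front [simp]: "distinct (foldr (to_front S) ds xs) \<longleftrightarrow> distinct xs"
  by (induction ds) auto

lemma filter_foldr_to_front:
  "filter P (foldr (to_front S) ds xs) = foldr (to_front S) ds (filter P xs)"
  by (induction ds) (auto simp: filter_to_front)

section \<open>Blocks, multiplicities and changes of the zigzag sequence\<close>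

lemma on_blocks_append: "distinct b \<Longrightarrow> on_blocks m xs \<Longrightarrow> on_blocks (Suc m) (b @ xs)"
  unfolding on_blocks_def by (metis concat.simps(2) length_Cons set_ConsD)

text \<open>\<open>ys\<close> is the part of block \<open>d\<close> already written by the previous
  step. Sparseness keeps it disjoint from the owners of \<open>d\<close>, which complete the
  block.\<close>

lemma on_blocks_zigzag:
  assumes "\<And>x d. x \<in> set xs \<Longrightarrow> d \<in> S x \<Longrightarrow> Suc d \<notin> S x" "distinct xs"
    "distinct ys" "\<And>y. y \<in> set ys \<Longrightarrow> d \<notin> S y"
  shows "on_blocks (Suc n) (ys @ zigzag S [d..<d + n] xs)"
  using assms
proof (induction n arbitrary: d xs ys)
  case 0
  have "on_blocks 0 []" by (simp add: on_blocks_def)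
  then show ?case using on_blocks_append[OF 0(3), of 0 "[]"] by simp
next
  case (Suc n)
  let ?b = "filter (\<lambda>x. d \<in> S x) xs"
  have "on_blocks (Suc n) (rev ?b @ zigzag S [Suc d..<Suc d + n] (to_front S d xs))"
    using Suc.prems by (intro Suc.IH) auto
  moreover have "distinct (ys @ ?b)" using Suc.prems by auto
  ultimately have "on_blocks (Suc (Suc n))
      ((ys @ ?b) @ rev ?b @ zigzag S [Suc d..<Suc d + n] (to_front S d xs))"
    by (rule on_blocks_append[rotated])
  moreover have "[d..<d + Suc n] = d # [Suc d..<Suc d + n]" by (simp add: upt_rec)
  ultimately show ?case by simp
qed

lemma count_list_zigzag:
  assumes "distinct xs" "x \<in> set xs"
  shows "count_list (zigzag S ds xs) x = 2 * length (filter (\<lambda>d. d \<in> S x) ds)"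
  using assms
proof (induction ds arbitrary: xs)
  case (Cons d ds)
  then show ?case using Cons.IH[of "to_front S d xs"] by (simp add: count_list_distinct)
qed simp

lemma set_zigzag_subset: "set (zigzag S ds xs) \<subseteq> set xs"
proof (induction ds arbitrary: xs)
  case (Cons d ds)
  then show ?case using Cons.IH[of "to_front S d xs"] by auto
qed simp

text \<open>The first letter of the current order is always the last letter written, so an element
  common to both sets costs two changes, any other element at most one.\<close>

lemma changes_zigzag_le:
  assumes "p \<noteq> q"
  shows "changes p (zigzag S ds [p, q]) \<le>
    length (filter (\<lambda>d. d \<in> S p) ds) + length (filter (\<lambda>d. d \<in> S q) ds)"
  using assms
proof (induction ds arbitrary: p q)
  case (Cons d ds)
  \<comment> \<open>If only \<open>q\<close> owns \<open>d\<close>, then \<open>q\<close> moves to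
    the front and the induction hypothesis applies with the roles swapped; otherwise
    \<open>p\<close> stays in front.\<close>
  show ?case
    using Cons.IH[OF Cons.prems] Cons.IH[OF Cons.prems[symmetric]] Cons.prems
    by (auto simp: to_front_def)
qed simp

lemma foldr_to_front_pair:
  "xs \<in> {[p, q], [q, p]} \<Longrightarrow> foldr (to_front S) ds xs \<in> {[p, q], [q, p]}"
  by (induction ds) (auto simp: to_front_def)

text \<open>Running the move-to-front steps backwards puts the owner of the first element on which the two
  sets differ in front, so that this element costs no change.\<close>

lemma changes_zigzag_less:
  assumes "p \<noteq> q" "foldr (to_front S) ds xs = [p, q]" "xs \<in> {[p, q], [q, p]}"
    "\<exists>d\<in>set ds. d \<in> S p \<longleftrightarrow> d \<notin> S q"
  shows "changes p (zigzag S ds [p, q]) <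
    length (filter (\<lambda>d. d \<in> S p) ds) + length (filter (\<lambda>d. d \<in> S q) ds)"
  using assms
proof (induction ds)
  case (Cons d ds)
  have step: "to_front S d (foldr (to_front S) ds xs) = [p, q]" using Cons.prems by simp
  have pair: "foldr (to_front S) ds xs \<in> {[p, q], [q, p]}"
    using Cons.prems(3) by (rule foldr_to_front_pair)
  show ?case
  proof (cases "d \<in> S p \<longleftrightarrow> d \<in> S q")
    case True
    then have "to_front S d ys = ys" if "ys \<in> {[p, q], [q, p]}" for ys
      using that by (auto simp: to_front_def)
    then have "foldr (to_front S) ds xs = [p, q]"
      using step pair by metis
    moreover have "\<exists>d\<in>set ds. d \<in> S p \<longleftrightarrow> d \<notin> S q" using Cons.prems(4) True by auto
    ultimately have "changes p (zigzag S ds [p, q]) <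
      length (filter (\<lambda>d. d \<in> S p) ds) + length (filter (\<lambda>d. d \<in> S q) ds)"
      using Cons.IH Cons.prems(1,3) by blast
    then show ?thesis using True Cons.prems(1) by (auto simp: to_front_def)
  next
    case False
    \<comment> \<open>The backward step at \<open>d\<close> left \<open>p\<close> in front, so
      \<open>p\<close> is the owner: writing \<open>p\<close> twice after \<open>p\<close> is free,
      while \<open>d\<close> counts once in the bound.\<close>
    have "to_front S d ys = [q, p]" if "ys \<in> {[p, q], [q, p]}" "d \<notin> S p" "d \<in> S q" for ys
      using that by (auto simp: to_front_def)
    then have "d \<in> S p" "d \<notin> S q"
      using step pair Cons.prems(1) False by (metis list.inject)+
    then show ?thesis
      using changes_zigzag_le[OF Cons.prems(1), of S ds] by (simp add: to_front_def)
  qed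
qed simp

section \<open>Assembling the extremal sequence\<close>

lemma filter_upt_pair:
  "a < b \<Longrightarrow> b < n \<Longrightarrow> filter (\<lambda>x. x \<in> {a, b}) [0..<n] = [a, b]" for a b n :: nat
proof (intro strict_sorted_equal)
  assume "a < b" "b < n"
  then show "set (filter (\<lambda>x. x \<in> {a, b}) [0..<n]) = set [a, b]" by auto
qed (auto intro: sorted_wrt_filter)

lemma length_filter_upt: "D \<subseteq> {..<n} \<Longrightarrow> length (filter (\<lambda>d. d \<in> D) [0..<n]) = card D"
proof -
  assume "D \<subseteq> {..<n}"
  then have "{i. i < n \<and> i \<in> D} = D" by auto
  then show ?thesis by (simp add: length_filter_conv_card conj_commute cong: conj_cong)
qed

text \<open>A single order \<open>L\<close> serves all pairs, since its restriction to a pair is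
  that pair's own backward order. Injectivity of \<open>S\<close> provides the element that makes
  the bound \<open>2 * t\<close> strict.\<close>

lemma zigzag_pair:
  fixes S :: "nat \<Rightarrow> nat set"
  assumes S: "inj_on S {..<N}" "\<And>x. x < N \<Longrightarrow> S x \<subseteq> {..<n} \<and> card (S x) = t"
    and ab: "a \<noteq> b" "a < N" "b < N"
  defines "L \<equiv> foldr (to_front S) [0..<n] [0..<N]"
  obtains p q where "p \<noteq> q" "filter (\<lambda>x. x \<in> {a, b}) L = [p, q]"
    "changes p (filter (\<lambda>x. x \<in> {a, b}) (zigzag S [0..<n] L)) < 2 * t"
proof -
  define xs where "xs = filter (\<lambda>x. x \<in> {a, b}) [0..<N]"
  have xs: "xs \<in> {[a, b], [b, a]}"
    using ab filter_upt_pair[of a b N] filter_upt_pair[of b a N]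
    unfolding xs_def by (cases a b rule: linorder_cases) (auto simp: disj_commute)
  have L: "filter (\<lambda>x. x \<in> {a, b}) L = foldr (to_front S) [0..<n] xs"
    by (simp add: L_def xs_def filter_foldr_to_front)
  obtain p q where pq: "foldr (to_front S) [0..<n] xs = [p, q]" "{p, q} = {a, b}"
    using foldr_to_front_pair[OF xs, of S "[0..<n]"] by auto
  have neq: "p \<noteq> q" and lt: "p < N" "q < N" using pq ab by (auto simp: doubleton_eq_iff)
  have "S p \<noteq> S q" using S(1) neq lt by (auto dest: inj_onD)
  then have "\<exists>d\<in>set [0..<n]. d \<in> S p \<longleftrightarrow> d \<notin> S q" using S(2) lt by fastforce
  then have "changes p (zigzag S [0..<n] [p, q]) < 2 * t"
    using changes_zigzag_less[OF neq pq(1)] xs pq(2) S(2) lt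
    by (auto simp: length_filter_upt doubleton_eq_iff)
  then show ?thesis using that neq L pq(1) by (simp add: filter_zigzag)
qed

text \<open>An alternation of length \<open>Suc s\<close> has at least \<open>s\<close> changes from
  any start \<open>c\<close>, and passing to a subsequence never adds changes.\<close>

lemma avoids_alternations_if_changes:
  assumes "\<And>a b. a \<in> set xs \<Longrightarrow> b \<in> set xs \<Longrightarrow> a \<noteq> b \<Longrightarrow>
      \<exists>c. changes c (filter (\<lambda>x. x \<in> {a, b}) xs) < s"
    and "s > 0"
  shows "avoids_alternations (Suc s) xs"
  unfolding avoids_alternations_def
proof
  assume "\<exists>ys. subseq ys xs \<and> is_alternation (Suc s) ys"
  then obtain a b where ab: "a \<noteq> b" and sub: "subseq (alternation a b (Suc s)) xs"
    by (auto simp: is_alternation_iff)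
  obtain r where r: "s = Suc r" using \<open>s > 0\<close> gr0_implies_Suc by blast
  have "{a, b} \<subseteq> set (alternation a b (Suc s))" by (simp add: r)
  also have "\<dots> \<subseteq> set xs" using sub by (auto dest: list_emb_set)
  finally obtain c where c: "changes c (filter (\<lambda>x. x \<in> {a, b}) xs) < s"
    using assms(1) ab by (metis insert_subset)
  have "filter (\<lambda>x. x \<in> {a, b}) (alternation a b (Suc s)) = alternation a b (Suc s)"
    using subsetD[OF set_alternation_subset[of a b "Suc s"]] by (intro filter_True ballI)
  then have "subseq (alternation a b (Suc s)) (filter (\<lambda>x. x \<in> {a, b}) xs)"
    using subseq_filter[OF sub, of "\<lambda>x. x \<in> {a, b}"] by (simp only:)
  from changes_mono_subseq[OF this, of c] changes_alternation_ge[OF ab, of s c] c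
  show False by linarith
qed

lemma exists_extremal_sequence:
  assumes "t > 0" "s = 2 * t + e" "e \<le> 1"
  obtains xs :: "nat list" where "on_blocks (Suc n + e) xs" "avoids_alternations (Suc s) xs"
    "\<forall>x\<in>set xs. s \<le> count_list xs x" "card (set xs) = card (sparse_sets n t)"
proof -
  define N where "N = card (sparse_sets n t)"
  obtain S where S: "bij_betw S {..<N} (sparse_sets n t)"
    using ex_bij_betw_nat_finite[OF finite_sparse_sets] by (auto simp: N_def atLeast0LessThan)
  have S_in: "S x \<in> sparse_sets n t" if "x < N" for x
    using S that by (auto simp: bij_betw_def)
  then have sub: "S x \<subseteq> {..<n} \<and> card (S x) = t" if "x < N" for x
    using that by (auto simp: sparse_sets_def)
  define L where "L = foldr (to_front S) [0..<n] [0..<N]"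
  have L: "distinct L" "set L = {..<N}" by (auto simp: L_def)
  define W where "W = zigzag S [0..<n] L"
  define pre where "pre = (if e = 0 then [] else rev L)"
  have count_W: "count_list W x = 2 * t" if "x < N" for x
    using that L sub[OF that] by (simp add: W_def count_list_zigzag length_filter_upt)
  have count: "count_list (pre @ W) x = s" if "x < N" for x
    using that L count_W[OF that] assms by (auto simp: pre_def count_list_distinct)
  have set: "set (pre @ W) = {..<N}"
  proof
    show "set (pre @ W) \<subseteq> {..<N}" using L set_zigzag_subset[of S _ L] by (auto simp: pre_def W_def)
    have "count_list (pre @ W) x \<noteq> 0" if "x < N" for x using count[OF that] assms by simp
    then show "{..<N} \<subseteq> set (pre @ W)" by (meson count_notin lessThan_iff subsetI)
  qed
  have "on_blocks (Suc n) W"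
    using on_blocks_zigzag[of L S "[]" 0 n] L S_in by (auto simp: W_def sparse_sets_def)
  then have blocks: "on_blocks (Suc n + e) (pre @ W)"
    using assms(3) L on_blocks_append[of "rev L"] by (cases e) (auto simp: pre_def)
  have "avoids_alternations (Suc s) (pre @ W)"
  proof (rule avoids_alternations_if_changes)
    fix a b assume "a \<in> set (pre @ W)" "b \<in> set (pre @ W)" "a \<noteq> b"
    then have ab: "a \<noteq> b" "a < N" "b < N" unfolding set by auto
    obtain p q where pq: "p \<noteq> q" "filter (\<lambda>x. x \<in> {a, b}) L = [p, q]"
      "changes p (filter (\<lambda>x. x \<in> {a, b}) W) < 2 * t"
      using zigzag_pair[of S N n t a b, OF bij_betw_imp_inj_on[OF S] sub ab]
      unfolding W_def L_def by metis
    show "\<exists>c. changes c (filter (\<lambda>x. x \<in> {a, b}) (pre @ W)) < s"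
    proof (cases "e = 0")
      case True
      then show ?thesis using pq assms by (auto simp: pre_def)
    next
      case False
      then have "filter (\<lambda>x. x \<in> {a, b}) pre = [q, p]" using pq(2) by (simp add: pre_def rev_filter[symmetric])
      \<comment> \<open>Starting from \<open>q\<close>, the prefix \<open>[q, p]\<close> costs one
        change and ends in \<open>p\<close>, the start for which \<open>W\<close> is
        bounded.\<close>
      then have "changes q (filter (\<lambda>x. x \<in> {a, b}) (pre @ W)) < s"
        using pq False assms by simp
      then show ?thesis by blast
    qed
  qed (use assms in auto)
  then show ?thesis using that blocks count set by (simp add: N_def)
qed

(* Truncated subtraction agrees with the convention that binomial coefficients
   with negative upper argument vanish: the lower argument is positive. *)
theorem mainTheorem1:
  fixes s m :: nat
  assumes "s \<ge> 2" and "m \<ge> 1"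
  shows "max_letters (s + 1) s m =
           enat ((m - nat \<lceil>real s / 2\<rceil>) choose nat \<lfloor>real s / 2\<rfloor>)"
proof -
  define t e where "t = s div 2" and "e = s mod 2"
  have t: "t > 0" "s = 2 * t + e" "e \<le> 1" using assms by (auto simp: t_def e_def)
  have "\<lfloor>real s / 2\<rfloor> = int t" using t by (intro floor_unique) auto
  then have floor: "nat \<lfloor>real s / 2\<rfloor> = t" by simp
  have "\<lceil>real s / 2\<rceil> = int (t + e)" using t by (intro ceiling_unique) auto
  then have ceiling: "nat \<lceil>real s / 2\<rceil> = t + e" by simp
  have binom: "card (sparse_sets (m - Suc e) t) = (m - (t + e)) choose t"
  \<comment> \<open>For \<open>m \<le> e\<close> the difference \<open>m - Suc e\<close> truncates,
    but both sides are 0 because \<open>t > 0\<close>.\<close>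
  proof (cases "e < m")
    case True
    then have "Suc (m - Suc e) - t = m - (t + e)" by simp
    then show ?thesis by (simp add: card_sparse_sets)
  next
    case False
    then show ?thesis using t by (simp add: card_sparse_sets)
  qed
  have "max_letters (s + 1) s m = enat (card (sparse_sets (m - Suc e) t))"
  proof (rule antisym)
    show "max_letters (s + 1) s m \<le> enat (card (sparse_sets (m - Suc e) t))"
      unfolding max_letters_def
    proof (rule SUP_least)
      fix xs :: "nat list"
      assume xs: "xs \<in> {xs. on_blocks m xs \<and> avoids_alternations (s + 1) xs \<and>
                       (\<forall>x\<in>set xs. s \<le> count_list xs x)}"
      then obtain bs where bs: "length bs = m" "\<forall>b\<in>set bs. distinct b" "xs = concat bs"
        by (auto simp: on_blocks_def)
      have "card (set (concat bs)) \<le> card (sparse_sets (length bs - (Suc s - 2 * t)) t)"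
        using xs bs t by (intro card_letters_le) auto
      then show "enat (card (set xs)) \<le> enat (card (sparse_sets (m - Suc e) t))"
        using bs t by simp
    qed
    show "enat (card (sparse_sets (m - Suc e) t)) \<le> max_letters (s + 1) s m"
    \<comment> \<open>The construction has exactly \<open>m\<close> blocks only if
      \<open>e < m\<close>; otherwise the claimed number is 0.\<close>
    proof (cases "e < m")
      case True
      then have m: "Suc (m - Suc e) + e = m" by simp
      obtain xs :: "nat list" where "on_blocks m xs" "avoids_alternations (Suc s) xs"
        "\<forall>x\<in>set xs. s \<le> count_list xs x" "card (set xs) = card (sparse_sets (m - Suc e) t)"
        using exists_extremal_sequence[OF t, of "m - Suc e"] unfolding m by blast
      then show ?thesis unfolding max_letters_def by (intro SUP_upper2[of xs]) auto
    next
      case False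
      then have "card (sparse_sets (m - Suc e) t) = 0" unfolding binom using t by simp
      then show ?thesis by (simp add: zero_enat_def[symmetric])
    qed
  qed
  then show ?thesis unfolding binom floor ceiling .
qed

end
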